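(* For $t_1,t_2\in K$ with $0<|t_i|<1$ $(i=1,2)$, the groups $N_1(t_1)$ and $N_1(t_2)$ are conjugate subgroups of $\mathrm{PGL}(2,K)$ if and only if $t_1/t_2\in\mathbf{F}_q^*$.
   Context: $K$ is a complete non-archimedean valued field of characteristic $p>0$ with absolute value $|\cdot|$, $q=p^m$ with $m>0$, and $K\supseteq\mathbf{F}_q$. For $t\in K^\times$, $N_1(t)$ is the subgroup of $\mathrm{PGL}(2,K)$ generated by all $\varepsilon_u$ and $\varepsilon'_u$, $u\in\mathbf{F}_q$, where $$\varepsilon_u=\begin{pmatrix}1&u\\ 0&1\end{pmatrix},\quad \tau=\begin{pmatrix}0&t\\ 1&0\end{pmatrix},\quad \varepsilon'_u=\tau\varepsilon_u\tau=\begin{pmatrix}t&0\\ u&t\end{pmatrix}.$$ *)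

theory Defs
  imports "HOL-Analysis.Analysis" "HOL-Algebra.Algebraic_Closure_Type"
begin

locale nonarch_valued_field =
  fixes v :: "'a::field \<Rightarrow> real"
  assumes nonneg: "v x \<ge> 0"
    and eq_0_iff: "v x = 0 \<longleftrightarrow> x = 0"
    and mult: "v (x * y) = v x * v y"
    and ultrametric: "v (x + y) \<le> max (v x) (v y)"
begin

lemma v_1: "v 1 = 1"
  using mult[of 1 1] eq_0_iff[of 1] by simp

lemma v_minus: "v (- x) = v x"
proof -
  have "v (- 1) * v (- 1) = 1"
    using mult[of "- 1" "- 1"] v_1 by simp
  then have "v (- 1) = 1"
    using nonneg[of "- 1"] by (metis abs_of_nonneg real_sqrt_abs2 real_sqrt_one)
  then show ?thesis
    using mult[of "- 1" x] by simp
qed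

sublocale Metric_space UNIV "\<lambda>x y. v (x - y)"
proof
  show "v (x - y) = v (y - x)" for x y
    using v_minus[of "x - y"] by simp
  show "v (x - z) \<le> v (x - y) + v (y - z)" for x y z
    using ultrametric[of "x - y" "y - z"] nonneg[of "x - y"] nonneg[of "y - z"] by simp
qed (simp_all add: nonneg eq_0_iff)

end

locale complete_nonarch_valued_field = nonarch_valued_field +
  assumes complete: "Metric_space.mcomplete UNIV (\<lambda>x y. v (x - y))"

definition mat2 :: "'a::zero \<Rightarrow> 'a \<Rightarrow> 'a \<Rightarrow> 'a \<Rightarrow> 'a^2^2" where
  "mat2 a b c d = vector [vector [a, b], vector [c, d]]"

definition GL2 :: "('a::field^2^2) monoid" where
  "GL2 = \<lparr>carrier = {A. invertible A}, mult = (**), one = mat 1\<rparr>"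

definition scalars2 :: "('a::field^2^2) set" where
  "scalars2 = {mat c | c. c \<noteq> 0}"

definition PGL2 :: "('a::field^2^2) set monoid" where
  "PGL2 = GL2 Mod scalars2"

definition pgl_class :: "'a::field^2^2 \<Rightarrow> ('a^2^2) set" where
  "pgl_class A = scalars2 #>\<^bsub>GL2\<^esub> A"

lemma GL2_group: "group (GL2 :: ('a::field^2^2) monoid)"
proof (rule groupI)
  fix A :: "'a^2^2"
  assume "A \<in> carrier GL2"
  then obtain B where "A ** B = mat 1" "B ** A = mat 1"
    by (auto simp: GL2_def invertible_def)
  then show "\<exists>B \<in> carrier GL2. B \<otimes>\<^bsub>GL2\<^esub> A = \<one>\<^bsub>GL2\<^esub>"
    by (auto simp: GL2_def invertible_def)
next
  show "A \<otimes>\<^bsub>GL2\<^esub> B \<in> carrier GL2"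
    if "A \<in> carrier GL2" "B \<in> carrier GL2" for A B :: "'a^2^2"
    using that by (simp add: GL2_def invertible_mult)
  show "\<one>\<^bsub>GL2\<^esub> \<in> carrier (GL2 :: ('a^2^2) monoid)"
    by (auto simp: GL2_def invertible_def intro!: exI[of _ "mat 1"])
qed (simp_all add: GL2_def matrix_mul_assoc)

lemma mat_mult_2: "(mat c :: 'a::field^2^2) ** mat d = mat (c * d)"
  by (simp add: vec_eq_iff matrix_matrix_mult_def mat_def sum_2 forall_2 mult.commute)

lemma mat_commute_2: "(mat c :: 'a::field^2^2) ** A = (A :: 'a^2^2) ** mat c"
  by (simp add: vec_eq_iff matrix_matrix_mult_def mat_def sum_2 forall_2 mult.commute)

lemma scalars2_normal: "scalars2 \<lhd> (GL2 :: ('a::field^2^2) monoid)"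
proof -
  interpret group "GL2 :: ('a^2^2) monoid" by (rule GL2_group)
  have inv_mat: "inv\<^bsub>GL2\<^esub> (mat c :: 'a^2^2) = mat (inverse c)" and
       mat_in: "(mat c :: 'a^2^2) \<in> carrier GL2" if "c \<noteq> 0" for c
  proof -
    have in_carrier: "(mat d :: 'a^2^2) \<in> carrier GL2" if "d \<noteq> 0" for d
      using that
      by (auto simp: GL2_def invertible_def mat_mult_2 intro!: exI[of _ "mat (inverse d)"])
    show "(mat c :: 'a^2^2) \<in> carrier GL2"
      using in_carrier that .
    show "inv\<^bsub>GL2\<^esub> (mat c :: 'a^2^2) = mat (inverse c)"
      by (rule inv_equality) (use that in_carrier in \<open>simp_all add: GL2_def mat_mult_2\<close>)
  qed
  have "subgroup scalars2 (GL2 :: ('a^2^2) monoid)"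
  proof (rule subgroupI)
    show "scalars2 \<subseteq> carrier (GL2 :: ('a^2^2) monoid)"
      using mat_in by (auto simp: scalars2_def)
    show "(scalars2 :: ('a^2^2) set) \<noteq> {}"
      by (auto simp: scalars2_def intro: exI[of _ 1])
    show "inv\<^bsub>GL2\<^esub> A \<in> scalars2" if "A \<in> scalars2" for A :: "'a^2^2"
    proof -
      from that obtain c where "A = mat c" "c \<noteq> 0" by (auto simp: scalars2_def)
      then show ?thesis
        using inv_mat[of c] by (auto simp: scalars2_def intro!: exI[of _ "inverse c"])
    qed
    show "A \<otimes>\<^bsub>GL2\<^esub> B \<in> scalars2"
      if "A \<in> scalars2" "B \<in> scalars2" for A B :: "'a^2^2"
    proof -
      from that obtain c d where "A = mat c" "c \<noteq> 0" "B = mat d" "d \<noteq> 0"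
        by (auto simp: scalars2_def)
      then show ?thesis
        by (auto simp: scalars2_def GL2_def mat_mult_2 intro!: exI[of _ "c * d"])
    qed
  qed
  moreover have "scalars2 #>\<^bsub>GL2\<^esub> A = A <#\<^bsub>GL2\<^esub> scalars2" for A :: "'a^2^2"
    by (auto simp: r_coset_def l_coset_def scalars2_def GL2_def mat_commute_2)
  ultimately show ?thesis
    by (intro normalI) simp_all
qed

lemma PGL2_group: "group (PGL2 :: ('a::field^2^2) set monoid)"
  unfolding PGL2_def by (rule normal.factorgroup_is_group[OF scalars2_normal])

definition eps :: "'a::field \<Rightarrow> 'a^2^2" where
  "eps u = mat2 1 u 0 1"

definition tau :: "'a::field \<Rightarrow> 'a^2^2" where
  "tau t = mat2 0 t 1 0"

definition eps' :: "'a::field \<Rightarrow> 'a \<Rightarrow> 'a^2^2" where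
  "eps' t u = tau t ** eps u ** tau t"

lemma eps'_eq: "eps' t u = mat2 t 0 u t"
  by (simp add: eps'_def tau_def eps_def mat2_def vec_eq_iff matrix_matrix_mult_def sum_2
      forall_2 vector_2)

(* The parameter F is the subfield F_q of K. *)
definition N1 :: "'a::field set \<Rightarrow> 'a \<Rightarrow> ('a^2^2) set set" where
  "N1 F t = generate PGL2 (pgl_class ` (eps ` F \<union> eps' t ` F))"

lemma N1_subgroup:
  assumes "t \<noteq> 0"
  shows "subgroup (N1 F t) PGL2"
proof -
  have "eps u ** eps (- u) = mat 1" "eps (- u) ** eps u = mat 1" for u :: 'a
    by (simp_all add: eps_def mat2_def mat_def vec_eq_iff matrix_matrix_mult_def sum_2
        forall_2 vector_2)
  then have eps: "eps u \<in> carrier GL2" for u :: 'a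
    by (auto simp: GL2_def invertible_def)
  have "tau t ** mat2 0 1 (inverse t) 0 = mat 1" "mat2 0 1 (inverse t) 0 ** tau t = mat 1"
    using assms by (simp_all add: tau_def mat2_def mat_def vec_eq_iff matrix_matrix_mult_def
        sum_2 forall_2 vector_2)
  then have "tau t \<in> carrier GL2"
    by (auto simp: GL2_def invertible_def)
  with eps have "eps' t u \<in> carrier GL2" for u
    by (simp add: eps'_def GL2_def invertible_mult)
  with eps have "pgl_class ` (eps ` F \<union> eps' t ` F) \<subseteq> carrier PGL2"
    unfolding PGL2_def carrier_FactGroup pgl_class_def by blast
  then show ?thesis
    unfolding N1_def by (rule group.generate_is_subgroup[OF PGL2_group])
qed

definition conjugate_subgroups :: "('g, 'b) monoid_scheme \<Rightarrow> 'g set \<Rightarrow> 'g set \<Rightarrow> bool" where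
  "conjugate_subgroups G H H' \<longleftrightarrow>
     subgroup H G \<and> subgroup H' G \<and> (\<exists>g \<in> carrier G. H' = g <#\<^bsub>G\<^esub> H #>\<^bsub>G\<^esub> inv\<^bsub>G\<^esub> g)"

end

theory Submission
  imports Defs
begin

text \<open>
  Put \<open>s = 1 / t\<close>, so \<open>s\<close> has absolute value greater than 1. Modulo scalars, the group
  \<open>N1 F t\<close> consists of the products of upper unipotents \<open>eps u\<close> and lower unipotents
  \<open>lower (w * s)\<close> with \<open>u\<close> and \<open>w\<close> in \<open>F\<close>. If \<open>t1 / t2\<close> is a nonzero constant, then
  \<open>F / t1 = F / t2\<close>, and the two groups are not only conjugate but equal.

  The converse reads the parameter off the traces. Nonzero constants have absolute value 1, since
  their powers run through a finite set. In a product of \<open>n > 0\<close> pairs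
  \<open>eps u ** lower (w * s)\<close> in which all \<open>u\<close> and \<open>w\<close> are nonzero, the trace therefore has one
  term of strictly largest absolute value, the product of all the \<open>u * w * s\<close>, and its absolute
  value is that of \<open>s ^ n\<close> (\<open>trace_reduced_word\<close>). A product of at least two pairs with
  a vanishing \<open>u\<close> or \<open>w\<close> can be shortened without changing its trace, because the trace is
  invariant under cyclic rotation. A single pair has trace \<open>2 + u * w * s\<close>. So the trace of any
  product is \<open>2 + c * s\<close> with \<open>c\<close> in \<open>F\<close>, or has absolute value at least that of \<open>s\<^sup>2\<close>
  (\<open>trace_word_cases\<close>).

  Traces are conjugation invariants of matrices, whereas an element of \<open>PGL2\<close> determines its matrix
  only up to a scalar. Determinants reduce this ambiguity to a sign. For a conjugate of a unipotent
  generator the sign is also determined: the trace is \<open>2\<close> or \<open>-2\<close>, and the only trace of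
  absolute value at most 1 that a product can have is 2 (\<open>unipotent_lift\<close>). Consequently, if
  \<open>N1 F t1\<close> is conjugated into \<open>N1 F t2\<close>, the matrix \<open>eps 1 ** lower (1 / t1)\<close>, of trace
  \<open>2 + 1 / t1\<close>, is conjugate to an honest product with parameter \<open>s2 = 1 / t2\<close>. Hence
  \<open>1 / t1 = c / t2\<close> for a constant \<open>c\<close>, or \<open>1 / t1\<close> is at least as large as \<open>1 / t2\<^sup>2\<close>
  (\<open>conj_parameter\<close>). By symmetry the same holds with \<open>t1\<close> and \<open>t2\<close> exchanged, and
  the two growth alternatives cannot hold together.
\<close>

section \<open>Two-by-two matrices and their classes\<close>

lemma mat2_mult:
  "mat2 a b c d ** mat2 a' b' c' d'
    = (mat2 (a * a' + b * c') (a * b' + b * d') (c * a' + d * c') (c * b' + d * d')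
       :: 'a::field^2^2)"
  by (simp add: mat2_def vec_eq_iff matrix_matrix_mult_def sum_2 forall_2)

lemma mat2_eq_iff: "mat2 a b c d = mat2 a' b' c' d' \<longleftrightarrow> a = a' \<and> b = b' \<and> c = c' \<and> d = d'"
  by (auto simp: mat2_def vec_eq_iff forall_2)

lemma mat_eq_mat2: "(mat c :: 'a::field^2^2) = mat2 c 0 0 c"
  by (simp add: mat2_def mat_def vec_eq_iff forall_2)

lemma mat2_cases: "\<exists>a b c d. (A :: 'a::field^2^2) = mat2 a b c d"
  by (simp add: mat2_def vec_eq_iff forall_2)

lemma det_mat2: "det (mat2 a b c d :: 'a::field^2^2) = a * d - b * c"
  by (simp add: mat2_def det_2)

lemma trace_mat2: "trace (mat2 a b c d :: 'a::field^2^2) = a + d"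
  by (simp add: mat2_def trace_def sum_2)

lemma invertible_if_det_1: "det (A :: 'a::field^2^2) = 1 \<Longrightarrow> invertible A"
  by (simp add: invertible_det_nz)

lemma trace_conj:
  assumes "G' ** G = mat 1"
  shows "trace (G ** A ** G') = trace (A :: 'a::field^2^2)"
proof -
  have "trace (G ** A ** G') = trace (G' ** (G ** A))"
    by (rule trace_mul_sym)
  then show ?thesis
    using assms by (simp add: matrix_mul_assoc)
qed

lemma pgl_class_eq: "pgl_class A = {mat c ** A | c. c \<noteq> 0}"
  by (auto simp: pgl_class_def r_coset_def scalars2_def GL2_def)

lemma pgl_class_eqD:
  assumes "pgl_class A = pgl_class B"
  obtains c where "c \<noteq> 0" "A = mat c ** B"
proof -
  have "A \<in> pgl_class A"
    by (auto simp: pgl_class_eq intro!: exI[of _ 1])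
  then show ?thesis
    using assms that by (auto simp: pgl_class_eq)
qed

lemma pgl_class_scale:
  assumes "c \<noteq> 0"
  shows "pgl_class (mat c ** A) = pgl_class A"
proof -
  have "\<exists>d'. mat d ** A = mat d' ** (mat c ** A) \<and> d' \<noteq> 0" if "d \<noteq> 0" for d
    using that assms
    by (intro exI[of _ "d / c"]) (simp add: matrix_mul_assoc mat_mult_2)
  moreover have "\<exists>d'. mat d ** (mat c ** A) = mat d' ** A \<and> d' \<noteq> 0" if "d \<noteq> 0" for d
    using that assms
    by (intro exI[of _ "d * c"]) (simp add: matrix_mul_assoc mat_mult_2)
  ultimately show ?thesis
    by (auto simp: pgl_class_eq)
qed

lemma carrier_PGL2: "carrier PGL2 = pgl_class ` {A. invertible A}"
  by (auto simp: PGL2_def carrier_FactGroup pgl_class_def GL2_def)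

lemma one_PGL2: "\<one>\<^bsub>PGL2\<^esub> = pgl_class (mat 1)"
  by (simp add: PGL2_def FactGroup_def pgl_class_eq scalars2_def)

lemma mult_PGL2:
  assumes "invertible A" "invertible B"
  shows "pgl_class A \<otimes>\<^bsub>PGL2\<^esub> pgl_class B = pgl_class (A ** B)"
  using normal.rcos_sum[OF scalars2_normal, of A B] assms
  by (simp add: PGL2_def FactGroup_def pgl_class_def GL2_def)

lemma inv_PGL2:
  assumes "A ** B = mat 1" "B ** A = mat 1"
  shows "inv\<^bsub>PGL2\<^esub> (pgl_class A) = pgl_class B"
proof -
  have "invertible A" "invertible B"
    using assms by (auto simp: invertible_def)
  then show ?thesis
    using assms
    by (intro group.inv_equality[OF PGL2_group]) (auto simp: mult_PGL2 one_PGL2 carrier_PGL2)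
qed

section \<open>Words in elementary matrices\<close>

definition lower :: "'a::field \<Rightarrow> 'a^2^2" where
  "lower w = mat2 1 0 w 1"

text \<open>
  Since the entries of a word may be zero, any product of upper and lower unipotents can be written in
  this alternating form, whichever kind it starts or ends with.
\<close>

fun word :: "'a::field \<Rightarrow> ('a \<times> 'a) list \<Rightarrow> 'a^2^2" where
  "word s [] = mat 1"
| "word s ((u, w) # xs) = eps u ** lower (w * s) ** word s xs"

lemma eps_mult: "eps u ** eps u' = eps (u + u')"
  by (simp add: eps_def mat2_mult mat2_eq_iff)

lemma lower_mult: "lower w ** lower w' = lower (w + w')"
  by (simp add: lower_def mat2_mult mat2_eq_iff)

lemma eps_0: "eps 0 = mat 1"
  by (simp add: eps_def mat_eq_mat2)

lemma lower_0: "lower 0 = mat 1"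
  by (simp add: lower_def mat_eq_mat2)

lemma det_eps: "det (eps u) = 1"
  by (simp add: eps_def det_mat2)

lemma det_lower: "det (lower w) = 1"
  by (simp add: lower_def det_mat2)

lemma trace_eps: "trace (eps u) = 2"
  by (simp add: eps_def trace_mat2)

lemma trace_lower: "trace (lower w) = 2"
  by (simp add: lower_def trace_mat2)

lemma trace_eps_lower: "trace (eps u ** lower w) = 2 + u * w"
  by (simp add: eps_def lower_def mat2_mult trace_mat2)

lemma eps'_eq_scaled_lower:
  assumes "t \<noteq> 0"
  shows "eps' t u = mat t ** lower (u * inverse t)"
  using assms by (simp add: eps'_eq lower_def mat_eq_mat2 mat2_mult mat2_eq_iff)

lemma word_append: "word s (xs @ ys) = word s xs ** word s ys"
  by (induction xs rule: word.induct[of _ s]) (simp_all add: matrix_mul_assoc)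

lemma det_word: "det (word s xs) = 1"
  by (induction xs rule: word.induct[of _ s]) (simp_all add: det_mul det_eps det_lower)

lemma trace_word_rotate: "trace (word s (xs @ ys)) = trace (word s (ys @ xs))"
  unfolding word_append by (rule trace_mul_sym)

definition words :: "'a::field set \<Rightarrow> 'a \<Rightarrow> ('a^2^2) set" where
  "words F s = word s ` lists (F \<times> F)"

lemma words_mult: "A \<in> words F s \<Longrightarrow> B \<in> words F s \<Longrightarrow> A ** B \<in> words F s"
  unfolding words_def by (force simp flip: word_append intro!: imageI)

lemma det_words: "A \<in> words F s \<Longrightarrow> det A = 1"
  by (auto simp: words_def det_word)

section \<open>The group as classes of words\<close>

text \<open>
  The trace estimates compare absolute values of monomials in \<open>s\<close>, so what matters about the
  constants is that the absolute value is trivial on them. Finite subfields have this property.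
\<close>

locale unit_subfield = nonarch_valued_field v for v :: "'a::field \<Rightarrow> real" +
  fixes F :: "'a set"
  assumes zero_mem: "0 \<in> F" and one_mem: "1 \<in> F"
    and add_mem: "x \<in> F \<Longrightarrow> y \<in> F \<Longrightarrow> x + y \<in> F"
    and uminus_mem: "x \<in> F \<Longrightarrow> - x \<in> F"
    and mult_mem: "x \<in> F \<Longrightarrow> y \<in> F \<Longrightarrow> x * y \<in> F"
    and inverse_mem: "x \<in> F \<Longrightarrow> inverse x \<in> F"
    and v_unit: "x \<in> F \<Longrightarrow> x \<noteq> 0 \<Longrightarrow> v x = 1"
begin

lemma one_words: "mat 1 \<in> words F s"
  unfolding words_def by (rule image_eqI[of _ _ "[]"]) auto

lemma eps_words: "u \<in> F \<Longrightarrow> eps u \<in> words F s"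
  unfolding words_def
  by (rule image_eqI[of _ _ "[(u, 0)]"]) (auto simp: lower_0 zero_mem)

lemma lower_words: "w \<in> F \<Longrightarrow> lower (w * s) \<in> words F s"
  unfolding words_def
  by (rule image_eqI[of _ _ "[(0, w)]"]) (auto simp: eps_0 zero_mem)

lemma N1_eq:
  assumes "t \<noteq> 0"
  shows "N1 F t = generate PGL2 (pgl_class ` (eps ` F \<union> (\<lambda>w. lower (w * inverse t)) ` F))"
  using assms
  by (simp add: N1_def image_Un image_image eps'_eq_scaled_lower pgl_class_scale)

text \<open>
  Words are closed under products, and the inverse of a generator is the generator with the negated
  entry, so lifting to matrices never requires a further scalar factor.
\<close>

lemma N1_subset_words:
  assumes "t \<noteq> 0" and "x \<in> N1 F t"
  shows "x \<in> pgl_class ` words F (inverse t)"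
  using assms(2) unfolding N1_eq[OF assms(1)]
proof (induction rule: generate.induct)
  case one
  then show ?case by (simp add: one_PGL2 one_words)
next
  case (incl h)
  then show ?case by (auto intro: eps_words lower_words)
next
  case (inv h)
  have e: "inv\<^bsub>PGL2\<^esub> (pgl_class (eps u)) = pgl_class (eps (- u))" for u :: 'a
    by (rule inv_PGL2) (simp_all add: eps_mult eps_0)
  have l: "inv\<^bsub>PGL2\<^esub> (pgl_class (lower (w * s))) = pgl_class (lower (- w * s))" for w s :: 'a
    by (rule inv_PGL2) (simp_all add: lower_mult lower_0)
  from inv consider u where "u \<in> F" "h = pgl_class (eps u)"
    | w where "w \<in> F" "h = pgl_class (lower (w * inverse t))"
    by auto
  then show ?case
    by cases (simp_all only: e l imageI eps_words lower_words uminus_mem)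
next
  case (eng h1 h2)
  then obtain A B where "A \<in> words F (inverse t)" "B \<in> words F (inverse t)"
      "h1 = pgl_class A" "h2 = pgl_class B"
    by auto
  then show ?case
    by (auto simp: mult_PGL2 invertible_if_det_1 det_words intro!: imageI words_mult)
qed

text \<open>Multiplication by a nonzero constant permutes \<open>F\<close>, hence the lower generators.\<close>

lemma N1_scale:
  assumes "t1 \<noteq> 0" and c: "c \<in> F" "c \<noteq> 0" and "t1 = c * t2"
  shows "N1 F t1 = N1 F t2"
proof -
  have "t2 \<noteq> 0"
    using assms by auto
  have "(\<lambda>w. lower (w * inverse t1)) ` F = (\<lambda>w. lower (w * inverse t2)) ` F"
  proof (intro equalityI image_subsetI)
    fix w assume "w \<in> F"
    have "w * inverse t1 = (w * inverse c) * inverse t2"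
      using assms by simp
    then show "lower (w * inverse t1) \<in> (\<lambda>w. lower (w * inverse t2)) ` F"
      using \<open>w \<in> F\<close> c by (intro image_eqI[of _ _ "w * inverse c"]) (auto simp: mult.assoc intro: mult_mem inverse_mem)
    have "w * inverse t2 = (w * c) * inverse t1"
      using assms by (simp add: mult.assoc)
    then show "lower (w * inverse t2) \<in> (\<lambda>w. lower (w * inverse t1)) ` F"
      using \<open>w \<in> F\<close> c by (intro image_eqI[of _ _ "w * c"]) (auto simp: mult.assoc intro: mult_mem)
  qed
  then show ?thesis
    by (simp add: N1_eq assms(1) \<open>t2 \<noteq> 0\<close>)
qed

section \<open>Traces of words\<close>

text \<open>
  In an ultrametric triangle the two longest sides are equal; otherwise \<open>x = (x + y) - y\<close> would be
  smaller than itself.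
\<close>

lemma v_add_dominant:
  assumes "v y < v x"
  shows "v (x + y) = v x"
proof -
  have "v x \<le> max (v (x + y)) (v y)"
    using ultrametric[of "x + y" "- y"] v_minus[of y] by simp
  then show ?thesis
    using ultrametric[of x y] assms by auto
qed

lemma v_2_le: "v 2 \<le> 1"
  using ultrametric[of 1 1] v_1 by simp

text \<open>
  The first column grows by a factor \<open>s\<close> with every pair, while the second column stays smaller by
  one such factor. The exact value is recorded for the upper left entry, which dominates the trace;
  upper bounds on the other three entries suffice to carry the induction. For the empty word the
  lower right entry is 1 and violates the bound of the second column, hence the case distinction.
\<close>

lemma reduced_word_growth:
  assumes R: "1 < v s" and "set xs \<subseteq> (F - {0}) \<times> (F - {0})"
  shows "\<exists>a b c d. word s xs = mat2 a b c d \<and> v a = v s ^ length xs \<and> v c \<le> v s ^ length xs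
           \<and> v s * v b \<le> v s ^ length xs
           \<and> (if xs = [] then d = 1 else v s * v d \<le> v s ^ length xs)"
  using assms(2)
proof (induction xs)
  case Nil
  then show ?case
    using v_1 eq_0_iff[of 0]
    by (intro exI[of _ 1] exI[of _ 0]) (simp add: mat_eq_mat2)
next
  case (Cons p xs)
  let ?n = "length xs"
  obtain u w where p: "p = (u, w)" by force
  have uw: "v u = 1" "v w = 1"
    using Cons.prems by (auto simp: v_unit p)
  obtain a b c d where
    W: "word s xs = mat2 a b c d" and a: "v a = v s ^ ?n" and c: "v c \<le> v s ^ ?n"
    and b: "v s * v b \<le> v s ^ ?n" and d: "if xs = [] then d = 1 else v s * v d \<le> v s ^ ?n"
    using Cons.IH Cons.prems by (metis insert_subset list.simps(15))
  define x where "x = 1 + u * w * s"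
  have "v (u * w * s) = v s"
    using uw by (simp add: mult)
  then have x: "v x = v s"
    using v_add_dominant[of 1 "u * w * s"] R v_1 by (simp add: x_def add.commute)
  have R1: "v s ^ ?n < v s * v s ^ ?n"
    using R by simp
  have d1: "v d \<le> v s ^ ?n"
  proof (cases "xs = []")
    case True
    then show ?thesis using d v_1 by simp
  next
    case False
    have "v d \<le> v s * v d"
      using R nonneg[of d] mult_right_mono[of 1 "v s" "v d"] by simp
    then show ?thesis using d False by simp
  qed
  have "word s ((u, w) # xs) = mat2 (x * a + u * c) (x * b + u * d) (w * s * a + c) (w * s * b + d)"
    by (simp add: W eps_def lower_def mat2_mult mat2_eq_iff x_def algebra_simps)
  moreover have "v (x * a + u * c) = v s ^ Suc ?n"
  proof -
    have "v (u * c) < v (x * a)"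
      using a c R1 by (simp add: mult uw x)
    then show ?thesis
      using v_add_dominant by (simp add: mult x a)
  qed
  moreover have "v (w * s * a + c) \<le> v s ^ Suc ?n"
    using ultrametric[of "w * s * a" c] a c R1 by (simp add: mult uw)
  moreover have "v (x * b + u * d) \<le> v s ^ ?n"
    using ultrametric[of "x * b" "u * d"] b d1 by (simp add: mult uw x)
  then have "v s * v (x * b + u * d) \<le> v s ^ Suc ?n"
    using R by simp
  moreover have "v (w * s * b + d) \<le> v s ^ ?n"
    using ultrametric[of "w * s * b" d] b d1 by (simp add: mult uw)
  then have "v s * v (w * s * b + d) \<le> v s ^ Suc ?n"
    using R by simp
  ultimately show ?case
    by (auto simp: p)
qed

lemma trace_reduced_word:
  assumes R: "1 < v s" and "set xs \<subseteq> (F - {0}) \<times> (F - {0})" and "xs \<noteq> []"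
  shows "v (trace (word s xs)) = v s ^ length xs"
proof -
  obtain a b c d where W: "word s xs = mat2 a b c d" and a: "v a = v s ^ length xs"
    and d: "v s * v d \<le> v s ^ length xs"
    using reduced_word_growth[OF assms(1,2)] assms(3) by auto
  have "v d < v a"
  proof (cases "d = 0")
    case True
    then show ?thesis using a R eq_0_iff[of 0] by simp
  next
    case False
    then have "0 < v d"
      using nonneg[of d] eq_0_iff[of d] by simp
    then have "v d < v s * v d"
      using R by simp
    then show ?thesis using a d by simp
  qed
  then show ?thesis
    using v_add_dominant by (simp add: W trace_mat2 a)
qed

text \<open>
  Cyclic reduction: a word of at least two pairs that contains a zero entry can be rotated so that the
  two unipotents next to the zero, which are of the same kind, merge. This preserves the trace and
  shortens the word. The process ends at a word with at most one pair, of trace \<open>2 + u * w * s\<close>, or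
  at a longer word with nonzero entries.
\<close>

lemma trace_word_cases:
  assumes R: "1 < v s" and "set xs \<subseteq> F \<times> F"
  shows "(\<exists>c\<in>F. trace (word s xs) = 2 + c * s) \<or> (v s)\<^sup>2 \<le> v (trace (word s xs))"
  using assms(2)
proof (induction xs rule: length_induct)
  case (1 xs)
  have shorten: ?case
    if "trace (word s xs) = trace (word s ys)" "length ys < length xs" "set ys \<subseteq> F \<times> F" for ys
    using 1 that by simp
  consider "xs = []" | u w where "xs = [(u, w)]"
    | "2 \<le> length xs" "set xs \<subseteq> (F - {0}) \<times> (F - {0})"
    | x where "2 \<le> length xs" "x \<in> set xs" "fst x = 0 \<or> snd x = 0"
  proof (cases "length xs < 2")
    case True
    then show ?thesis
      using that(1,2) by (cases xs) (auto simp: numeral_2_eq_2)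
  next
    case False
    then show ?thesis
      using that(3,4) "1.prems" by (cases "\<exists>x\<in>set xs. fst x = 0 \<or> snd x = 0") force+
  qed
  then show ?case
  proof cases
    case 1
    then show ?thesis
      using zero_mem by (auto simp: trace_I intro: bexI[of _ 0])
  next
    case (2 u w)
    then have "trace (word s xs) = 2 + (u * w) * s" "u * w \<in> F"
      using "1.prems" trace_eps_lower[of u "w * s"] by (auto simp: mult.assoc mult_mem)
    then show ?thesis
      by blast
  next
    case 3
    then have "xs \<noteq> []" by auto
    then show ?thesis
      using trace_reduced_word[OF R 3(2)] 3(1) R by simp
  next
    case (4 x)
    then obtain ys zs where xs: "xs = ys @ x # zs"
      by (meson split_list)
    have rot: "trace (word s xs) = trace (word s (x # zs @ ys))"
      using trace_word_rotate[of s ys "x # zs"] xs by simp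
    obtain u w where x: "x = (u, w)" by force
    have mem: "u \<in> F" "w \<in> F" "set (zs @ ys) \<subseteq> F \<times> F"
      using "1.prems" by (auto simp: xs x)
    have len: "length xs = Suc (length (zs @ ys))"
      by (simp add: xs)
    show ?thesis
    proof (cases "w = 0")
      \<comment> \<open>Without a lower factor, the upper factor of \<open>x\<close> meets that of the next pair.\<close>
      case True
      obtain u' w' rs where rs: "zs @ ys = (u', w') # rs"
        using 4(1) len by (cases "zs @ ys") auto
      have "word s (x # zs @ ys) = word s ((u + u', w') # rs)"
        by (simp add: x rs True lower_0 matrix_mul_assoc flip: eps_mult)
      then show ?thesis
        using rot mem len by (intro shorten[of "(u + u', w') # rs"]) (auto simp: rs add_mem)
    next
      \<comment> \<open>Without an upper factor, the lower factor of \<open>x\<close> meets that of the cyclically preceding pair.\<close>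
      case False
      then have u: "u = 0"
        using 4(3) x by simp
      obtain u' w' rs where rs: "zs @ ys = rs @ [(u', w')]"
        using 4(1) len by (cases "zs @ ys" rule: rev_cases) auto
      have "lower ((w' + w) * s) = lower (w' * s) ** lower (w * s)"
        by (simp add: lower_mult distrib_right)
      then have "word s ([(u', w')] @ x # rs) = word s ((u', w' + w) # rs)"
        by (simp add: x u eps_0 matrix_mul_assoc)
      moreover have "trace (word s (x # zs @ ys)) = trace (word s ([(u', w')] @ x # rs))"
        using trace_word_rotate[of s "x # rs" "[(u', w')]"] by (simp add: rs)
      ultimately show ?thesis
        using rot mem len by (intro shorten[of "(u', w' + w) # rs"]) (auto simp: rs add_mem)
    qed
  qed
qed

lemma trace_words_cases:
  assumes "1 < v s" and "A \<in> words F s"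
  shows "(\<exists>c\<in>F. trace A = 2 + c * s) \<or> (v s)\<^sup>2 \<le> v (trace A)"
proof -
  obtain xs where A: "A = word s xs" and "xs \<in> lists (F \<times> F)"
    using assms(2) unfolding words_def by (rule imageE)
  then have "set xs \<subseteq> F \<times> F"
    by (simp add: lists_eq_set)
  then show ?thesis
    unfolding A by (rule trace_word_cases[OF assms(1)])
qed

lemma v_two_plus:
  assumes "1 < v s" and "c \<in> F" "c \<noteq> 0"
  shows "v (2 + c * s) = v s"
proof -
  have "v (c * s) = v s"
    using assms by (simp add: mult v_unit)
  then show ?thesis
    using v_add_dominant[of 2 "c * s"] v_2_le assms(1) by (simp add: add.commute[of 2])
qed

lemma trace_words_small:
  assumes R: "1 < v s" and "A \<in> words F s" and "v (trace A) \<le> 1"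
  shows "trace A = 2"
proof -
  have "1 < (v s)\<^sup>2"
    using R by simp
  then obtain c where c: "c \<in> F" "trace A = 2 + c * s"
    using trace_words_cases[OF assms(1,2)] assms(3) by auto
  then have "c = 0"
    using v_two_plus[OF R] assms(3) R by fastforce
  then show ?thesis using c by simp
qed

section \<open>Recovering the parameter from a conjugation\<close>

text \<open>
  This resolves the scalar ambiguity of \<open>PGL2\<close>: comparing determinants gives \<open>c = 1\<close> or
  \<open>c = -1\<close>. In the second case \<open>W\<close> has trace \<open>-2\<close>, of absolute value at most 1, so
  \<open>W\<close> has trace 2 as well; then \<open>4 = 0\<close>, the characteristic is 2, and \<open>-1 = 1\<close>.
\<close>

lemma unipotent_lift:
  assumes R: "1 < v s" and W: "W \<in> words F s"
    and eq: "B = mat c ** W" and "det B = 1" and "trace B = 2"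
  shows "B \<in> words F s"
proof -
  obtain w11 w12 w21 w22 where w: "W = mat2 w11 w12 w21 w22"
    using mat2_cases by blast
  have "det W = 1"
    using det_words W .
  then have "c * c = 1"
    using \<open>det B = 1\<close> by (simp add: eq det_mul) (simp add: mat_eq_mat2 det_mat2)
  then have c: "c = 1 \<or> c = - 1"
    by (metis square_eq_1_iff)
  have tr: "c * trace W = 2"
    using \<open>trace B = 2\<close> by (simp add: eq w mat_eq_mat2 mat2_mult trace_mat2 algebra_simps)
  have "c = 1"
    using c
  proof
    assume m: "c = - 1"
    then have "trace W = - 2"
      using tr by (metis minus_minus mult_minus1)
    moreover from this have "trace W = 2"
      using trace_words_small[OF R W] v_2_le by (simp add: v_minus)
    ultimately have "(2::'a) + 2 = 0"
      by (metis add.left_inverse)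
    then have "(2::'a) * 2 = 0"
      by (simp only: mult_2)
    then have "(1::'a) + 1 = 0"
      by (simp only: mult_eq_0_iff one_add_one) simp
    then show "c = 1"
      unfolding m by (rule add.inverse_unique)
  qed
  then show ?thesis
    using eq W by simp
qed

text \<open>
  Lifting the product \<open>eps 1 ** lower (inverse t1)\<close> directly would leave its sign open. Both of
  its factors are unipotent, so they are lifted separately and multiplied afterwards.
\<close>

lemma conj_parameter:
  assumes t: "t1 \<noteq> 0" "t2 \<noteq> 0" and R: "1 < v (inverse t2)"
    and g: "g \<in> carrier PGL2"
    and conj: "\<And>x. x \<in> N1 F t1 \<Longrightarrow> g \<otimes>\<^bsub>PGL2\<^esub> x \<otimes>\<^bsub>PGL2\<^esub> inv\<^bsub>PGL2\<^esub> g \<in> N1 F t2"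
  shows "(\<exists>c\<in>F. inverse t1 = c * inverse t2) \<or> (v (inverse t2))\<^sup>2 \<le> v (2 + inverse t1)"
proof -
  obtain G G' where G: "g = pgl_class G" "G ** G' = mat 1" "G' ** G = mat 1"
    using g by (auto simp: carrier_PGL2 invertible_def)
  have inv: "invertible G" "invertible G'"
    using G by (auto simp: invertible_def)
  have conj_unipotent: "G ** A ** G' \<in> words F (inverse t2)"
    if A: "pgl_class A \<in> N1 F t1" "det A = 1" "trace A = 2" for A
  proof -
    have "pgl_class (G ** A ** G') \<in> N1 F t2"
      using conj[OF A(1)] G inv A(2)
      by (simp add: mult_PGL2 inv_PGL2[OF G(2,3)] invertible_if_det_1 invertible_mult)
    then obtain W where W: "W \<in> words F (inverse t2)" "pgl_class (G ** A ** G') = pgl_class W"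
      using N1_subset_words[OF t(2)] by blast
    then obtain c where "G ** A ** G' = mat c ** W"
      by (auto elim: pgl_class_eqD)
    moreover have "trace (G ** A ** G') = 2"
      using A(3) by (simp add: trace_conj[OF G(3)])
    moreover have "det (G ** A ** G') = det A * det (G ** G')"
      by (simp add: det_mul)
    then have "det (G ** A ** G') = 1"
      using A G by simp
    ultimately show ?thesis
      using unipotent_lift[OF R W(1)] by blast
  qed
  let ?E = "eps (1 :: 'a)" and ?L = "lower (1 * inverse t1)"
  have "pgl_class ?E \<in> N1 F t1" "pgl_class ?L \<in> N1 F t1"
    unfolding N1_eq[OF t(1)] using one_mem by (blast intro: generate.incl)+
  then have "G ** ?E ** G' \<in> words F (inverse t2)" "G ** ?L ** G' \<in> words F (inverse t2)"
    by (auto intro!: conj_unipotent simp: det_eps det_lower trace_eps trace_lower)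
  then have "(G ** ?E ** G') ** (G ** ?L ** G') \<in> words F (inverse t2)"
    by (rule words_mult)
  moreover have "(G ** ?E ** G') ** (G ** ?L ** G') = G ** (?E ** ?L) ** G'"
    using G by (metis matrix_mul_assoc matrix_mul_rid)
  ultimately have mem: "G ** (?E ** ?L) ** G' \<in> words F (inverse t2)"
    by simp
  have "trace (G ** (?E ** ?L) ** G') = trace (?E ** ?L)"
    by (rule trace_conj[OF G(3)])
  also have "\<dots> = 2 + inverse t1"
    using trace_eps_lower[of 1 "1 * inverse t1"] by simp
  finally show ?thesis
    using trace_words_cases[OF R mem] by auto
qed

lemma conjugate_imp_ratio:
  assumes t1: "0 < v t1" "v t1 < 1" and t2: "0 < v t2" "v t2 < 1"
    and conj: "conjugate_subgroups PGL2 (N1 F t1) (N1 F t2)"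
  shows "t1 / t2 \<in> F - {0}"
proof -
  interpret PGL: group PGL2 by (rule PGL2_group)
  have nz: "t1 \<noteq> 0" "t2 \<noteq> 0"
    using t1 t2 eq_0_iff[of t1] eq_0_iff[of t2] by auto
  have "v (inverse t) * v t = 1" if "t \<noteq> 0" for t
    using that v_1 by (simp flip: mult)
  then have v_inv: "v (inverse t) = inverse (v t)" if "t \<noteq> 0" for t
    using that by (metis inverse_unique mult.commute)
  have R: "1 < v (inverse t1)" "1 < v (inverse t2)"
    using t1 t2 nz by (simp_all add: v_inv one_less_inverse)
  have ratio_mem: "t1 / t2 \<in> F - {0}" if "c \<in> F" "inverse t1 = c * inverse t2" for c
  proof -
    have "t1 / t2 = inverse c"
      using that(2) nz by (metis inverse_inverse_eq inverse_mult_distrib divide_inverse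
          nonzero_mult_div_cancel_right mult.commute inverse_eq_divide)
    then show ?thesis
      using that nz inverse_mem by auto
  qed
  have ratio_mem': "t1 / t2 \<in> F - {0}" if "c \<in> F" "inverse t2 = c * inverse t1" for c
  proof -
    have "t1 / t2 = c"
      using that(2) nz by (simp add: field_simps)
    then show ?thesis
      using that nz by auto
  qed
  have sub: "N1 F t1 \<subseteq> carrier PGL2"
    using N1_subgroup[OF nz(1)] by (rule subgroup.subset)
  obtain g where g: "g \<in> carrier PGL2"
    and N: "N1 F t2 = g <#\<^bsub>PGL2\<^esub> N1 F t1 #>\<^bsub>PGL2\<^esub> inv\<^bsub>PGL2\<^esub> g"
    using conj unfolding conjugate_subgroups_def by blast
  have fwd: "g \<otimes>\<^bsub>PGL2\<^esub> x \<otimes>\<^bsub>PGL2\<^esub> inv\<^bsub>PGL2\<^esub> g \<in> N1 F t2" if "x \<in> N1 F t1" for x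
    using that unfolding N l_coset_def r_coset_def by blast
  have bwd: "inv\<^bsub>PGL2\<^esub> g \<otimes>\<^bsub>PGL2\<^esub> y \<otimes>\<^bsub>PGL2\<^esub> inv\<^bsub>PGL2\<^esub> (inv\<^bsub>PGL2\<^esub> g) \<in> N1 F t1"
    if y: "y \<in> N1 F t2" for y
  proof -
    obtain x where x: "x \<in> N1 F t1" "y = g \<otimes>\<^bsub>PGL2\<^esub> x \<otimes>\<^bsub>PGL2\<^esub> inv\<^bsub>PGL2\<^esub> g"
      using y unfolding N l_coset_def r_coset_def by blast
    then have "x \<in> carrier PGL2"
      using sub by blast
    then have "inv\<^bsub>PGL2\<^esub> g \<otimes>\<^bsub>PGL2\<^esub> y \<otimes>\<^bsub>PGL2\<^esub> inv\<^bsub>PGL2\<^esub> (inv\<^bsub>PGL2\<^esub> g) = x"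
      using g by (simp add: x(2) PGL.m_assoc PGL.inv_solve_left')
    then show ?thesis
      using x by simp
  qed
  have v12: "v (2 + inverse t1) = v (inverse t1)" "v (2 + inverse t2) = v (inverse t2)"
    using v_two_plus[OF R(1) one_mem] v_two_plus[OF R(2) one_mem] by simp_all
  have "\<not> ((v (inverse t2))\<^sup>2 \<le> v (inverse t1) \<and> (v (inverse t1))\<^sup>2 \<le> v (inverse t2))"
  proof -
    have "a < a\<^sup>2" if "1 < a" for a :: real
      using that by (simp add: power2_eq_square)
    from this[OF R(1)] this[OF R(2)] show ?thesis
      by linarith
  qed
  moreover have "(\<exists>c\<in>F. inverse t1 = c * inverse t2) \<or> (v (inverse t2))\<^sup>2 \<le> v (inverse t1)"
    using conj_parameter[OF nz R(2) g fwd] v12 by simp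
  moreover have "(\<exists>c\<in>F. inverse t2 = c * inverse t1) \<or> (v (inverse t1))\<^sup>2 \<le> v (inverse t2)"
    using conj_parameter[OF nz(2,1) R(1) PGL.inv_closed[OF g] bwd] v12 by simp
  ultimately show ?thesis
    using ratio_mem ratio_mem' by blast
qed

lemma ratio_imp_conjugate:
  assumes "t1 \<noteq> 0" "t2 \<noteq> 0" and "t1 / t2 \<in> F - {0}"
  shows "conjugate_subgroups PGL2 (N1 F t1) (N1 F t2)"
proof -
  interpret PGL: group PGL2 by (rule PGL2_group)
  have sub: "subgroup (N1 F t1) PGL2"
    using N1_subgroup assms by blast
  have eq: "N1 F t2 = N1 F t1"
    using N1_scale[of t1 "t1 / t2" t2] assms by simp
  have "N1 F t1 = \<one>\<^bsub>PGL2\<^esub> <#\<^bsub>PGL2\<^esub> N1 F t1 #>\<^bsub>PGL2\<^esub> inv\<^bsub>PGL2\<^esub> \<one>\<^bsub>PGL2\<^esub>"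
    using subgroup.subset[OF sub] by (simp add: PGL.lcos_mult_one)
  then show ?thesis
    unfolding conjugate_subgroups_def eq using sub PGL.one_closed by blast
qed

end

text \<open>
  Everything follows from finiteness. Translation by an element and multiplication by a nonzero
  element are injective maps of \<open>F\<close> into itself, hence surjective, which yields negatives and
  inverses. If some \<open>v x\<close> exceeded 1, the powers of \<open>x\<close> would be unbounded; applied to \<open>x\<close> and
  to its inverse, this leaves only \<open>v x = 1\<close>.
\<close>

lemma (in nonarch_valued_field) finite_subfield_unit_subfield:
  assumes F: "subfield F (ring_of_type_algebra :: 'a ring)" and fin: "finite F"
  shows "unit_subfield v F"
proof -
  let ?R = "ring_of_type_algebra :: 'a ring"
  have sub: "subring F ?R"
    using subfieldE(1)[OF F] .
  have zero: "0 \<in> F" and one: "1 \<in> F"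
    and add: "\<And>x y. x \<in> F \<Longrightarrow> y \<in> F \<Longrightarrow> x + y \<in> F"
    and mul: "\<And>x y. x \<in> F \<Longrightarrow> y \<in> F \<Longrightarrow> x * y \<in> F"
    using subringE[OF sub] by (simp_all add: ring_of_type_algebra_def)
  have neg: "- x \<in> F" if "x \<in> F" for x
  proof -
    have "(+) x ` F = F"
      using that add by (intro endo_inj_surj[OF fin]) auto
    then obtain y where "y \<in> F" "x + y = 0"
      using zero by (metis imageE)
    then show ?thesis
      by (metis add.inverse_unique)
  qed
  have inv: "inverse x \<in> F" if "x \<in> F" for x
  proof (cases "x = 0")
    case False
    then have "(*) x ` F = F"
      using that mul by (intro endo_inj_surj[OF fin]) (auto simp: inj_on_def)
    then obtain y where "y \<in> F" "x * y = 1"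
      using one by (metis imageE)
    then show ?thesis
      by (metis inverse_unique)
  qed (simp add: zero)
  have v_le: "v x \<le> 1" if x: "x \<in> F" for x
  proof (rule ccontr)
    assume "\<not> v x \<le> 1"
    then have gt: "1 < v x" by simp
    have pow: "x ^ n \<in> F" for n
      using x by (induction n) (auto simp: one mul)
    have v_pow: "v (x ^ n) = v x ^ n" for n
      by (induction n) (simp_all add: v_1 mult)
    obtain n where "Max (v ` F) < v x ^ n"
      using real_arch_pow[OF gt] by blast
    moreover have "v (x ^ n) \<le> Max (v ` F)"
      using fin pow by (intro Max_ge) auto
    ultimately show False
      using v_pow by simp
  qed
  have "v x = 1" if "x \<in> F" "x \<noteq> 0" for x
  proof -
    have "v x * v (inverse x) = 1"
      using that v_1 by (simp flip: mult)
    moreover have "v x \<le> 1" "v (inverse x) \<le> 1"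
      using that v_le inv by auto
    ultimately show ?thesis
      using nonneg[of x] mult_left_le[of "v (inverse x)" "v x"] by linarith
  qed
  then show ?thesis
    using zero one add mul neg inv by unfold_locales auto
qed

theorem corollary9p6:
  fixes v :: "'a::field \<Rightarrow> real"
    and F :: "'a set"
    and p m q :: nat
    and t1 t2 :: 'a
  assumes "complete_nonarch_valued_field v"
    and "CHAR('a) = p" and "p > 0"
    and "q = p ^ m" and "m > 0"
    and "subfield F (ring_of_type_algebra :: 'a ring)" and "card F = q"
    and "0 < v t1" and "v t1 < 1"
    and "0 < v t2" and "v t2 < 1"
  shows "conjugate_subgroups PGL2 (N1 F t1) (N1 F t2) \<longleftrightarrow> t1 / t2 \<in> F - {0}"
proof -
  interpret complete_nonarch_valued_field v by fact
  have "0 < card F"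
    using assms by simp
  then have "finite F"
    by (rule card_ge_0_finite)
  then interpret unit_subfield v F
    using finite_subfield_unit_subfield assms by blast
  have "t1 \<noteq> 0" "t2 \<noteq> 0"
    using assms(8,10) eq_0_iff[of t1] eq_0_iff[of t2] by auto
  then show ?thesis
    using conjugate_imp_ratio ratio_imp_conjugate assms by blast
qed

end
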